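(* Let $p=1$. The mixture model generated by the family $\mathfrak{L}=\{L(\,\cdot\,;\mu,\sigma):(\mu,\sigma)\in\Theta\}$ of univariate logistic distribution functions, with parameter set $\Theta=\mathbb{R}\times(0,\infty)$ and mixing distributions in the set $\mathfrak{R}$ of probability distributions on $\Theta$ with finite support, is identifiable. That is, for all $G_1,G_2\in\mathfrak{R}$, $$H(x,G_1)=H(x,G_2)\ \text{ for all } x\in\mathbb{R}\quad\Longleftrightarrow\quad G_1=G_2 .$$
   Context: For $\mu\in\mathbb{R}$ and $\sigma\in(0,\infty)$, the univariate logistic cumulative distribution function is $$L(x;\mu,\sigma)=\bigl[1+\exp(-(x-\mu)/\sigma)\bigr]^{-1},\qquad x\in\mathbb{R}.$$ For a probability distribution $G$ on $\Theta=\mathbb{R}\times(0,\infty)$ with finite support, the $G$-mixture of $\mathfrak{L}$ is $$H(x,G)=\int_{\Theta}L(x;\mu,\sigma)\,dG(\mu,\sigma),$$ i.e. $H(x,G)=\sum_{i=1}^s\pi_i L(x;\mu_i,\sigma_i)$ if $G$ has distinct atoms $(\mu_i,\sigma_i)$ with masses $\pi_i>0$, $\sum_{i=1}^s\pi_i=1$. *)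

theory Defs
  imports "HOL-Probability.Probability"
begin

definition logistic_cdf :: "real \<Rightarrow> real \<Rightarrow> real \<Rightarrow> real" where
  "logistic_cdf x \<mu> \<sigma> = inverse (1 + exp (- ((x - \<mu>) / \<sigma>)))"

definition Theta :: "(real \<times> real) set" where
  "Theta = UNIV \<times> {0<..}"

text \<open>A probability distribution with finite support is determined by its point masses, so it is
  represented by a pmf; the pmf lives on the ambient plane and is required to be supported
  in \<^const>\<open>Theta\<close>.\<close>

definition finite_mixing :: "(real \<times> real) pmf set" where
  "finite_mixing = {G. finite (set_pmf G) \<and> set_pmf G \<subseteq> Theta}"

definition mixture_cdf :: "real \<Rightarrow> (real \<times> real) pmf \<Rightarrow> real" where
  "mixture_cdf x G =
     set_lebesgue_integral (measure_pmf G) Theta (\<lambda>(\<mu>, \<sigma>). logistic_cdf x \<mu> \<sigma>)"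

lemma mixture_cdf_eq_sum:
  assumes "G \<in> finite_mixing"
  shows "mixture_cdf x G = (\<Sum>(\<mu>, \<sigma>)\<in>set_pmf G. pmf G (\<mu>, \<sigma>) * logistic_cdf x \<mu> \<sigma>)"
proof -
  from assms have fin: "finite (set_pmf G)" and sub: "set_pmf G \<subseteq> Theta"
    by (auto simp: finite_mixing_def)
  have "mixture_cdf x G = (\<Sum>\<theta>\<in>set_pmf G.
      pmf G \<theta> *\<^sub>R (indicator Theta \<theta> *\<^sub>R (case \<theta> of (\<mu>, \<sigma>) \<Rightarrow> logistic_cdf x \<mu> \<sigma>)))"
    unfolding mixture_cdf_def set_lebesgue_integral_def
    using fin by (intro integral_measure_pmf) auto
  also have "\<dots> = (\<Sum>(\<mu>, \<sigma>)\<in>set_pmf G. pmf G (\<mu>, \<sigma>) * logistic_cdf x \<mu> \<sigma>)"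
    using sub by (intro sum.cong) auto
  finally show ?thesis .
qed

end

theory Submission
  imports Defs "HOL-Complex_Analysis.Complex_Analysis"
begin

text \<open>Identifiability amounts to linear independence of the logistic functions. Clearing
  denominators in a vanishing linear combination yields an entire function that is zero on the
  real line, hence everywhere. Among the atoms with nonzero coefficient take one,
  \<open>(\<mu>, \<sigma>)\<close>, of minimal scale: its pole \<open>\<mu> + \<i>\<pi>\<sigma>\<close> is not a pole of any other atom, so evaluating
  there leaves only its own coefficient times a nonzero factor.\<close>

text \<open>The reciprocal of the logistic function, continued to an entire function of
  \<open>z\<close>. The parameters form one pair so that products can be indexed by atoms.\<close>

definition logistic_denom :: "real \<times> real \<Rightarrow> complex \<Rightarrow> complex" where
  "logistic_denom \<theta> z = 1 + exp (- ((z - of_real (fst \<theta>)) / of_real (snd \<theta>)))"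

lemma holomorphic_logistic_denom [holomorphic_intros]:
  "snd \<theta> \<noteq> 0 \<Longrightarrow> logistic_denom \<theta> holomorphic_on A"
  unfolding logistic_denom_def by (intro holomorphic_intros) auto

lemma logistic_denom_of_real:
  "logistic_denom \<theta> (of_real x) = of_real (1 + exp (- ((x - fst \<theta>) / snd \<theta>)))"
  by (simp add: logistic_denom_def exp_of_real [symmetric])

lemma logistic_denom_of_real_nonzero: "logistic_denom \<theta> (of_real x) \<noteq> 0"
proof -
  have "1 + exp (- ((x - fst \<theta>) / snd \<theta>)) > 0"
    by (intro add_pos_pos) auto
  then show ?thesis
    unfolding logistic_denom_of_real of_real_eq_0_iff by linarith
qed

lemma logistic_cdf_eq_inverse_denom:
  "of_real (logistic_cdf x \<mu> \<sigma>) = inverse (logistic_denom (\<mu>, \<sigma>) (of_real x))"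
  by (simp add: logistic_denom_of_real logistic_cdf_def)

lemma logistic_denom_pole:
  assumes "\<sigma> > 0"
  shows "logistic_denom (\<mu>, \<sigma>) (Complex \<mu> (pi * \<sigma>)) = 0"
proof -
  have "Complex \<mu> (pi * \<sigma>) - of_real \<mu> = of_real \<sigma> * (\<i> * of_real pi)"
    by (simp add: complex_eq_iff)
  then have "- ((Complex \<mu> (pi * \<sigma>) - of_real \<mu>) / of_real \<sigma>) = - (\<i> * of_real pi)"
    using assms by simp
  then show ?thesis
    by (simp add: logistic_denom_def exp_minus)
qed

text \<open>The exponential takes the value -1 = exp(i pi) exactly at the odd multiples of i pi, by
  its period 2 i pi; rescaling by \<sigma> and shifting by \<mu> gives the zeros.\<close>

lemma logistic_denom_eq_0_iff:
  assumes "\<sigma> > 0"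
  shows "logistic_denom (\<mu>, \<sigma>) z = 0 \<longleftrightarrow> Re z = \<mu> \<and> (\<exists>k::int. Im z = (2 * real_of_int k + 1) * pi * \<sigma>)"
proof -
  have "logistic_denom (\<mu>, \<sigma>) z = 0 \<longleftrightarrow> exp ((of_real \<mu> - z) / of_real \<sigma>) = exp (\<i> * of_real pi)"
    by (simp add: logistic_denom_def add_eq_0_iff minus_divide_left)
  also have "\<dots> \<longleftrightarrow> (\<exists>n::int. (of_real \<mu> - z) / of_real \<sigma> = \<i> * of_real pi + of_int (2 * n) * of_real pi * \<i>)"
    unfolding exp_eq by (simp add: mult_ac)
  also have "\<dots> \<longleftrightarrow> Re z = \<mu> \<and> (\<exists>n::int. Im z = - (2 * real_of_int n + 1) * pi * \<sigma>)"
  proof -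
    have "(of_real \<mu> - z) / of_real \<sigma> = \<i> * of_real pi + of_int (2 * n) * of_real pi * \<i> \<longleftrightarrow>
        Re z = \<mu> \<and> Im z = - (2 * real_of_int n + 1) * pi * \<sigma>" for n :: int
      using assms by (auto simp: complex_eq_iff field_simps)
    then show ?thesis by simp
  qed
  also have "(\<exists>n::int. Im z = - (2 * real_of_int n + 1) * pi * \<sigma>) \<longleftrightarrow> (\<exists>k::int. Im z = (2 * real_of_int k + 1) * pi * \<sigma>)"
  proof
    assume "\<exists>n::int. Im z = - (2 * real_of_int n + 1) * pi * \<sigma>"
    then obtain n :: int where "Im z = - (2 * real_of_int n + 1) * pi * \<sigma>" ..
    then show "\<exists>k::int. Im z = (2 * real_of_int k + 1) * pi * \<sigma>"
      \<comment> \<open>Negation permutes the odd integers: -(2n + 1) = 2(-n - 1) + 1.\<close>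
      by (intro exI [of _ "- n - 1"]) (simp add: algebra_simps)
  next
    assume "\<exists>k::int. Im z = (2 * real_of_int k + 1) * pi * \<sigma>"
    then obtain k :: int where "Im z = (2 * real_of_int k + 1) * pi * \<sigma>" ..
    then show "\<exists>n::int. Im z = - (2 * real_of_int n + 1) * pi * \<sigma>"
      by (intro exI [of _ "- k - 1"]) (simp add: algebra_simps)
  qed
  finally show ?thesis .
qed

text \<open>The zeros for (\<nu>, \<tau>) lie over \<nu> at odd multiples of pi \<tau>. The smallest
  positive one is pi \<tau> itself, which is at least pi \<sigma>, so a common zero forces \<tau> =
  \<sigma>.\<close>

lemma logistic_denom_pole_unique:
  assumes "\<sigma> > 0" "\<tau> \<ge> \<sigma>" "logistic_denom (\<nu>, \<tau>) (Complex \<mu> (pi * \<sigma>)) = 0"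
  shows "(\<nu>, \<tau>) = (\<mu>, \<sigma>)"
proof -
  have "\<tau> > 0"
    using assms by simp
  then obtain k :: int where "\<nu> = \<mu>" and k: "\<sigma> = (2 * k + 1) * \<tau>"
    using assms(3) by (auto simp: logistic_denom_eq_0_iff)
  have "k \<ge> 0"
  proof (rule ccontr)
    assume "\<not> k \<ge> 0"
    then have "(2 * k + 1) * \<tau> \<le> 0"
      using \<open>\<tau> > 0\<close> by (intro mult_nonpos_nonneg) auto
    with k assms(1) show False by simp
  qed
  then have "(2 * k + 1) * \<tau> \<ge> 1 * \<tau>"
    using \<open>\<tau> > 0\<close> by (intro mult_right_mono) auto
  with k assms(2) \<open>\<nu> = \<mu>\<close> show ?thesis by simp
qed

lemma logistic_cdf_linear_independent:
  assumes fin: "finite S" and S: "S \<subseteq> Theta"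
    and zero: "\<And>x. (\<Sum>(\<mu>, \<sigma>)\<in>S. c (\<mu>, \<sigma>) * logistic_cdf x \<mu> \<sigma>) = 0"
    and "\<theta> \<in> S"
  shows "c \<theta> = (0::real)"
proof (rule ccontr)
  assume "c \<theta> \<noteq> 0"
  \<comment> \<open>Restricting to nonzero coefficients before minimising the scale makes
    \<open>c (\<mu>, \<sigma>) = 0\<close> a contradiction, whichever \<theta> was given.\<close>
  define T where "T = {\<theta> \<in> S. c \<theta> \<noteq> 0}"
  have T: "finite T" "T \<noteq> {}"
    using fin \<open>\<theta> \<in> S\<close> \<open>c \<theta> \<noteq> 0\<close> unfolding T_def by (simp, blast)
  have pos: "snd \<theta> > 0" if "\<theta> \<in> T" for \<theta>
    using that S by (auto simp: T_def Theta_def)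
  obtain \<mu> \<sigma> where in_T: "(\<mu>, \<sigma>) \<in> T" and least: "\<And>\<theta>. \<theta> \<in> T \<Longrightarrow> \<sigma> \<le> snd \<theta>"
    using arg_min_if_finite(1) [OF T, of snd] arg_min_least [OF T, of _ snd]
    by (metis surj_pair snd_conv)
  \<comment> \<open>The linear combination times the product of all denominators. Each summand omits
    its own factor instead of dividing by it, so no singularities arise.\<close>
  define F where "F z = (\<Sum>\<theta>\<in>T. of_real (c \<theta>) * (\<Prod>\<eta>\<in>T - {\<theta>}. logistic_denom \<eta> z))" for z
  define p where "p = Complex \<mu> (pi * \<sigma>)"
  have F_real: "F (of_real x) = 0" for x
  proof -
    have "F (of_real x) = (\<Sum>\<theta>\<in>T. (\<Prod>\<eta>\<in>T. logistic_denom \<eta> (of_real x)) *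
        of_real (c \<theta> * logistic_cdf x (fst \<theta>) (snd \<theta>)))"
      unfolding F_def
      by (intro sum.cong refl)
        (simp add: logistic_cdf_eq_inverse_denom logistic_denom_of_real_nonzero
          prod.remove [OF T(1)])
    also have "\<dots> = (\<Prod>\<eta>\<in>T. logistic_denom \<eta> (of_real x)) *
        of_real (\<Sum>\<theta>\<in>T. c \<theta> * logistic_cdf x (fst \<theta>) (snd \<theta>))"
      by (simp add: sum_distrib_left)
    also have "(\<Sum>\<theta>\<in>T. c \<theta> * logistic_cdf x (fst \<theta>) (snd \<theta>)) =
        (\<Sum>\<theta>\<in>S. c \<theta> * logistic_cdf x (fst \<theta>) (snd \<theta>))"
      using fin by (intro sum.mono_neutral_left) (auto simp: T_def)
    also have "\<dots> = 0"
      using zero [of x] by (simp add: case_prod_unfold)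
    finally show ?thesis by simp
  qed
  have "F holomorphic_on UNIV"
    unfolding F_def using pos by (intro holomorphic_intros) force
  \<comment> \<open>The identity theorem needs zeros of \<open>F\<close> that accumulate; the real
    points e/2 approach 0.\<close>
  moreover have "(0::complex) islimpt range of_real"
    unfolding islimpt_approachable
  proof (intro allI impI)
    fix e :: real
    assume "e > 0"
    then show "\<exists>w\<in>range of_real. w \<noteq> (0::complex) \<and> dist w 0 < e"
      by (intro bexI [of _ "of_real (e / 2)"]) (auto simp del: of_real_divide)
  qed
  ultimately have "F p = 0"
    by (intro analytic_continuation [of F UNIV "range of_real" 0 p]) (auto simp: F_real)
  moreover have "F p = of_real (c (\<mu>, \<sigma>)) * (\<Prod>\<eta>\<in>T - {(\<mu>, \<sigma>)}. logistic_denom \<eta> p)"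
  proof -
    \<comment> \<open>Every summand other than that of (\<mu>, \<sigma>) retains the factor of
      (\<mu>, \<sigma>), which vanishes at \<open>p\<close>.\<close>
    have "(\<Prod>\<eta>\<in>T - {\<theta>}. logistic_denom \<eta> p) = 0" if "\<theta> \<in> T - {(\<mu>, \<sigma>)}" for \<theta>
      using that T(1) in_T pos [OF in_T] logistic_denom_pole [of \<sigma> \<mu>]
      by (intro prod_zero bexI [of _ "(\<mu>, \<sigma>)"]) (auto simp: p_def)
    then show ?thesis
      unfolding F_def by (subst sum.remove [OF T(1) in_T]) simp
  qed
  \<comment> \<open>By minimality of \<sigma>, no other remaining denominator vanishes at
    \<open>p\<close>; an atom of equal scale differs in location.\<close>
  moreover have "logistic_denom \<eta> p \<noteq> 0" if "\<eta> \<in> T - {(\<mu>, \<sigma>)}" for \<eta>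
    using that least [of \<eta>] pos [OF in_T] logistic_denom_pole_unique [of \<sigma> "snd \<eta>" "fst \<eta>" \<mu>]
    by (auto simp: p_def)
  ultimately have "c (\<mu>, \<sigma>) = 0"
    using T(1) by simp
  with in_T show False by (simp add: T_def)
qed

theorem theorem1:
  fixes G1 G2 :: "(real \<times> real) pmf"
  assumes "G1 \<in> finite_mixing" and "G2 \<in> finite_mixing"
  shows "(\<forall>x::real. mixture_cdf x G1 = mixture_cdf x G2) \<longleftrightarrow> G1 = G2"
proof
  assume eq: "\<forall>x::real. mixture_cdf x G1 = mixture_cdf x G2"
  define S where "S = set_pmf G1 \<union> set_pmf G2"
  have S: "finite S" "S \<subseteq> Theta"
    using assms by (auto simp: S_def finite_mixing_def)
  \<comment> \<open>Points outside the support have mass 0, so both mixtures become sums over the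
    common set \<open>S\<close> and can be subtracted termwise.\<close>
  have sum_S: "mixture_cdf x G = (\<Sum>(\<mu>, \<sigma>)\<in>S. pmf G (\<mu>, \<sigma>) * logistic_cdf x \<mu> \<sigma>)"
    if "G \<in> finite_mixing" "set_pmf G \<subseteq> S" for x G
    unfolding mixture_cdf_eq_sum [OF that(1)]
    using S(1) that(2) by (intro sum.mono_neutral_left) (auto simp: set_pmf_iff)
  have "(\<Sum>(\<mu>, \<sigma>)\<in>S. (pmf G1 (\<mu>, \<sigma>) - pmf G2 (\<mu>, \<sigma>)) * logistic_cdf x \<mu> \<sigma>) = 0" for x
    using eq sum_S [OF assms(1), of x] sum_S [OF assms(2), of x]
    by (simp add: S_def left_diff_distrib sum_subtractf case_prod_unfold)
  then have "pmf G1 \<theta> - pmf G2 \<theta> = 0" if "\<theta> \<in> S" for \<theta>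
    using logistic_cdf_linear_independent [OF S, of "\<lambda>\<theta>. pmf G1 \<theta> - pmf G2 \<theta>"] that by simp
  then have "pmf G1 \<theta> = pmf G2 \<theta>" for \<theta>
    by (cases "\<theta> \<in> S") (auto simp: S_def set_pmf_iff)
  then show "G1 = G2"
    by (intro pmf_eqI)
qed simp

end
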